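(* Let $G$ be a graph of order $n$ with vertex set $V(G)=\{v_1,\dots,v_n\}$ and minimum degree $\delta$, and let $\mathbf{r}=(r_1,\dots,r_n)$ and $\mathbf{s}=(s_1,\dots,s_n)$ be $n$-tuples of nonnegative integers. Put $$\tau=\min\{r_1,\dots,r_n\},\quad s=\max\{s_1,\dots,s_n\},\quad r=\left\lfloor \frac{s}{\delta+1}\right\rfloor+1,\quad \theta=(\delta+1)r-s,\quad B_{s-1}=\binom{(\delta+1)r}{s-1}.$$ If $r\le\tau$, then $$\gamma\langle \mathbf{r},\mathbf{s}\rangle(G)\le\frac{\ln(\theta+1)+\ln B_{s-1}-\ln r+1}{\theta+1}\, r n .$$
   Context: All graphs are finite, undirected, without loops and multiple edges. $N[v]$ denotes the closed neighbourhood of $v$ (the neighbours of $v$ together with $v$). Let $\mathbf{N}$ denote the set of nonnegative integers. A function $f:V(G)\to\mathbf{N}$ is an $\mathbf{r}$-function of $G$ if $f(v_i)\le r_i$ for all $i=1,\dots,n$. An $\mathbf{r}$-function $f$ is $\mathbf{s}$-dominating if $\sum_{u\in N[v_i]}f(u)\ge s_i$ for all $i=1,\dots,n$. The weight of $f$ is $|f|=\sum_{i=1}^n f(v_i)$. The $\langle\mathbf{r},\mathbf{s}\rangle$-domination number $\gamma\langle\mathbf{r},\mathbf{s}\rangle(G)$ is the smallest weight of an $\mathbf{s}$-dominating $\mathbf{r}$-function of $G$ (such functions exist if and only if $\sum_{v_j\in N[v_i]}r_j\ge s_i$ for all $i=1,\dots,n$). *)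

theory Defs
  imports "HOL-Analysis.Analysis" "Graph_Theory.Pair_Digraph"
begin

text \<open>
  A finite simple undirected graph is a \<^locale>\<open>pair_graph\<close>: every edge is represented by both of
  its orientations, so that the degree of a vertex is its out-degree. An \<open>n\<close>-tuple
  with one entry per vertex is a function on the vertices; its values elsewhere are irrelevant.
\<close>

definition closed_neighbourhood :: "'a pair_pre_digraph \<Rightarrow> 'a \<Rightarrow> 'a set" where
  "closed_neighbourhood G v = insert v {u. (v, u) \<in> parcs G}"

definition min_degree :: "'a pair_pre_digraph \<Rightarrow> nat" where
  "min_degree G = Min (out_degree (with_proj G) ` pverts G)"

definition bounded_function :: "'a pair_pre_digraph \<Rightarrow> ('a \<Rightarrow> nat) \<Rightarrow> ('a \<Rightarrow> nat) \<Rightarrow> bool" where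
  "bounded_function G rs f \<longleftrightarrow> (\<forall>v \<in> pverts G. f v \<le> rs v)"

definition dominating :: "'a pair_pre_digraph \<Rightarrow> ('a \<Rightarrow> nat) \<Rightarrow> ('a \<Rightarrow> nat) \<Rightarrow> bool" where
  "dominating G ss f \<longleftrightarrow> (\<forall>v \<in> pverts G. (\<Sum>u \<in> closed_neighbourhood G v. f u) \<ge> ss v)"

definition weight :: "'a pair_pre_digraph \<Rightarrow> ('a \<Rightarrow> nat) \<Rightarrow> nat" where
  "weight G f = (\<Sum>v \<in> pverts G. f v)"

text \<open>The value is unspecified if no \<open>ss\<close>-dominating \<open>rs\<close>-function exists.\<close>

definition domination_number :: "'a pair_pre_digraph \<Rightarrow> ('a \<Rightarrow> nat) \<Rightarrow> ('a \<Rightarrow> nat) \<Rightarrow> nat" where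
  "domination_number G rs ss =
     (LEAST w. \<exists>f. bounded_function G rs f \<and> dominating G ss f \<and> weight G f = w)"

end

theory Submission
  imports Defs
begin

text \<open>
  Since \<open>r \<le> \<tau>\<close>, every function with values at most \<open>r\<close> is admissible. Such functions arise
  by taking \<open>r\<close> copies of every vertex and counting the chosen copies, so that one looks for a
  subset \<open>A\<close> of \<open>U = V \<times> {..<r}\<close>, where \<open>V\<close> is the vertex set, and its weight is \<open>card A\<close>. For each
  vertex \<open>v\<close> fix \<open>\<delta> + 1\<close> members of its closed neighbourhood, and let \<open>C v\<close> be the block
  of all \<open>(\<delta> + 1) r = s + \<theta>\<close> copies of these. A set contains at least \<open>s\<close> elements of \<open>C v\<close> iff it avoids
  at most \<open>\<theta>\<close> of them, that is, iff it meets every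
  \<open>(\<theta> + 1)\<close>-subset of \<open>C v\<close>. Hence \<open>s\<close>-domination follows from an ordinary hitting set
  problem on \<open>U\<close>, with sets of size \<open>\<theta> + 1\<close>. There are at most \<open>n B\<close> of them, because choosing
  \<open>\<theta> + 1\<close> of \<open>s + \<theta>\<close> elements means leaving out \<open>s - 1\<close>
  (there is no such choice if \<open>s = 0\<close>).

  For hitting sets there is the classical argument: put each element of \<open>U\<close> into \<open>A\<close>
  independently with probability \<open>p\<close>, and repair \<open>A\<close> by one element of each set it misses
  (\<open>exists_small_hitting_set\<close>; \<open>exists_small_multiple_hitting_set\<close> is the version for the \<open>C v\<close>). The
  expected size is at most \<open>p r n + n B (1 - p) ^ (\<theta> + 1)\<close>, which is at most
  \<open>p r n + n B exp (- p (\<theta> + 1))\<close>. The last expression is minimal at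
  \<open>p = (ln (\<theta> + 1) + ln B - ln r) / (\<theta> + 1)\<close>, where it equals the claimed bound. This \<open>p\<close> is never
  negative; if it exceeds 1, the bound exceeds \<open>r n\<close>, and all of \<open>U\<close> may be taken.
\<close>

text \<open>
  If \<open>A\<close> contains each element of \<open>U\<close> independently with probability \<open>p\<close>, then the right-hand side is
  the expected value of the left-hand side. The induction follows the method of conditional
  expectations: the right-hand side is the average, with weights \<open>p\<close> and \<open>1 - p\<close>, of the values
  obtained after putting \<open>x\<close> into \<open>A\<close> (which deletes the sets containing \<open>x\<close>) and after leaving \<open>x\<close> out (which removes \<open>x\<close> from all
  sets). Sets are indexed because removing \<open>x\<close> may make different sets equal.
\<close>

lemma exists_few_chosen_plus_missed:
  fixes p :: real and T :: "'j \<Rightarrow> 'a set"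
  assumes "finite U" "finite J" "\<And>j. j \<in> J \<Longrightarrow> T j \<subseteq> U" "0 \<le> p" "p \<le> 1"
  shows "\<exists>A\<subseteq>U. real (card A) + real (card {j \<in> J. T j \<inter> A = {}})
           \<le> p * real (card U) + (\<Sum>j\<in>J. (1 - p) ^ card (T j))"
  using assms(1-3)
proof (induction U arbitrary: J T rule: finite_induct)
  case empty
  then have "(\<Sum>j\<in>J. (1 - p) ^ card (T j)) = real (card J)"
    by simp
  then show ?case by simp
next
  case (insert x U)
  define J0 where "J0 = {j \<in> J. x \<notin> T j}"
  define J1 where "J1 = {j \<in> J. x \<in> T j}"
  have fin: "finite J0" "finite J1" and J: "J = J0 \<union> J1" "J0 \<inter> J1 = {}"
    using insert.prems by (auto simp: J0_def J1_def)
  define a where "a = (\<Sum>j\<in>J0. (1 - p) ^ card (T j))"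
  define b where "b = (\<Sum>j\<in>J1. (1 - p) ^ card (T j - {x}))"
  have sub: "T j - {x} \<subseteq> U" if "j \<in> J" for j
    using insert.prems(2)[OF that] by auto
  have finT: "finite (T j)" if "j \<in> J" for j
    using insert.prems(2)[OF that] insert.hyps(1) finite_subset by blast
  have "(\<Sum>j\<in>J1. (1 - p) ^ card (T j)) = (\<Sum>j\<in>J1. (1 - p) * (1 - p) ^ card (T j - {x}))"
  proof (rule sum.cong)
    fix j assume "j \<in> J1"
    then have "card (T j) = Suc (card (T j - {x}))"
      using finT by (intro card.remove) (auto simp: J1_def)
    then show "(1 - p) ^ card (T j) = (1 - p) * (1 - p) ^ card (T j - {x})"
      by simp
  qed simp
  then have total: "(\<Sum>j\<in>J. (1 - p) ^ card (T j)) = a + (1 - p) * b"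
    using fin J by (simp add: sum.union_disjoint a_def b_def sum_distrib_left)
  have "\<exists>A\<subseteq>U. real (card A) + real (card {j \<in> J0. T j \<inter> A = {}})
          \<le> p * real (card U) + (\<Sum>j\<in>J0. (1 - p) ^ card (T j))"
    using sub fin by (intro insert.IH) (auto simp: J0_def)
  then obtain A where A: "A \<subseteq> U"
    "real (card A) + real (card {j \<in> J0. T j \<inter> A = {}}) \<le> p * real (card U) + a"
    unfolding a_def by blast
  have "\<exists>A'\<subseteq>U. real (card A') + real (card {j \<in> J. (T j - {x}) \<inter> A' = {}})
          \<le> p * real (card U) + (\<Sum>j\<in>J. (1 - p) ^ card (T j - {x}))"
    using sub insert.prems by (intro insert.IH) auto
  moreover have "a = (\<Sum>j\<in>J0. (1 - p) ^ card (T j - {x}))"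
    unfolding a_def by (intro sum.cong) (auto simp: J0_def)
  then have "(\<Sum>j\<in>J. (1 - p) ^ card (T j - {x})) = a + b"
    using fin J by (simp add: sum.union_disjoint b_def)
  ultimately obtain A' where A': "A' \<subseteq> U"
    "real (card A') + real (card {j \<in> J. (T j - {x}) \<inter> A' = {}}) \<le> p * real (card U) + (a + b)"
    by auto
  have "finite A"
    using A(1) insert.hyps(1) finite_subset by blast
  then have card_A: "card (insert x A) = Suc (card A)"
    using A(1) insert.hyps(2) by (simp add: subset_iff card_insert_if) blast
  have missed_A: "{j \<in> J. T j \<inter> insert x A = {}} = {j \<in> J0. T j \<inter> A = {}}"
    by (auto simp: J0_def)
  have missed_A': "{j \<in> J. T j \<inter> A' = {}} = {j \<in> J. (T j - {x}) \<inter> A' = {}}"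
    using A'(1) insert.hyps(2) by blast
  define lim where "lim = p * real (card (insert x U)) + (\<Sum>j\<in>J. (1 - p) ^ card (T j))"
  define \<alpha> where "\<alpha> = 1 + (p * real (card U) + a)"
  define \<beta> where "\<beta> = p * real (card U) + (a + b)"
  have average: "p * \<alpha> + (1 - p) * \<beta> = lim"
    using insert.hyps by (simp add: lim_def total algebra_simps \<alpha>_def \<beta>_def)
  have "\<alpha> \<le> lim \<or> \<beta> \<le> lim"
  proof (rule ccontr)
    assume "\<not> ?thesis"
    then have "p * lim + (1 - p) * lim < p * \<alpha> + (1 - p) * \<beta>"
      using assms(4,5) by (cases "p = 0") (auto intro!: add_less_le_mono mult_left_mono)
    then show False
      using average by (simp add: algebra_simps)
  qed
  then show ?case
  proof
    assume "\<alpha> \<le> lim"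
    then show ?thesis
      using A card_A missed_A unfolding lim_def \<alpha>_def by (intro exI[of _ "insert x A"]) auto
  next
    assume "\<beta> \<le> lim"
    then show ?thesis
      using A' missed_A' unfolding lim_def \<beta>_def by (intro exI[of _ A']) auto
  qed
qed

text \<open>Repairing the set of the previous lemma by one element of each missed set.\<close>

lemma exists_small_hitting_set:
  fixes p :: real
  assumes "finite U" "\<F> \<subseteq> Pow U" "{} \<notin> \<F>" "0 \<le> p" "p \<le> 1"
  shows "\<exists>A\<subseteq>U. (\<forall>T\<in>\<F>. T \<inter> A \<noteq> {}) \<and>
           real (card A) \<le> p * real (card U) + (\<Sum>T\<in>\<F>. (1 - p) ^ card T)"
proof -
  have "finite \<F>"
    using assms(1,2) finite_subset by blast
  then obtain A where A: "A \<subseteq> U" "real (card A) + real (card {T \<in> \<F>. T \<inter> A = {}})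
      \<le> p * real (card U) + (\<Sum>T\<in>\<F>. (1 - p) ^ card T)"
    using exists_few_chosen_plus_missed[of U \<F> "\<lambda>T. T" p] assms by blast
  define M where "M = {T \<in> \<F>. T \<inter> A = {}}"
  obtain pick where pick: "\<And>T. T \<in> \<F> \<Longrightarrow> pick T \<in> T"
    using assms(3) by (metis ex_in_conv)
  have "A \<union> pick ` M \<subseteq> U"
    using A(1) pick assms(2) by (auto simp: M_def)
  moreover have "T \<inter> (A \<union> pick ` M) \<noteq> {}" if "T \<in> \<F>" for T
    using pick[OF that] that by (auto simp: M_def)
  moreover have "card (A \<union> pick ` M) \<le> card A + card M"
    using card_Un_le[of A "pick ` M"] card_image_le[of M pick] \<open>finite \<F>\<close>
    by (simp add: M_def)
  ultimately show ?thesis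
    using A(2) by (intro exI[of _ "A \<union> pick ` M"]) (auto simp: M_def)
qed

text \<open>
  Multiple covering of the sets \<open>C v\<close> as hitting of their subsets: if a set that meets all
  \<open>(\<theta> + 1)\<close>-subsets of \<open>C v\<close> had fewer than \<open>s\<close> elements in common with \<open>C v\<close>,
  then it would miss more than \<open>\<theta>\<close> elements of \<open>C v\<close>, hence one of these subsets.
\<close>

lemma exists_small_multiple_hitting_set:
  fixes p :: real
  assumes "finite U" "finite V" "\<And>v. v \<in> V \<Longrightarrow> C v \<subseteq> U" "\<And>v. v \<in> V \<Longrightarrow> card (C v) = s + \<theta>"
    "0 \<le> p" "p \<le> 1"
  shows "\<exists>A\<subseteq>U. (\<forall>v\<in>V. s \<le> card (C v \<inter> A)) \<and>
           real (card A) \<le> p * real (card U) +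
             real (card V) * (real ((s + \<theta>) choose (\<theta> + 1)) * (1 - p) ^ (\<theta> + 1))"
proof -
  define \<F> where "\<F> = (\<Union>v\<in>V. {T. T \<subseteq> C v \<and> card T = \<theta> + 1})"
  have finC: "finite (C v)" if "v \<in> V" for v
    using assms(1,3) that finite_subset by blast
  have "\<F> \<subseteq> Pow U" "{} \<notin> \<F>"
    using assms(3) by (auto simp: \<F>_def)
  then obtain A where A: "A \<subseteq> U" "\<forall>T\<in>\<F>. T \<inter> A \<noteq> {}"
    "real (card A) \<le> p * real (card U) + (\<Sum>T\<in>\<F>. (1 - p) ^ card T)"
    using exists_small_hitting_set[of U \<F> p] assms by blast
  have "card \<F> \<le> (\<Sum>v\<in>V. card {T. T \<subseteq> C v \<and> card T = \<theta> + 1})"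
    unfolding \<F>_def by (rule card_UN_le) (rule assms(2))
  also have "\<dots> = card V * ((s + \<theta>) choose (\<theta> + 1))"
    using n_subsets[OF finC, of _ "\<theta> + 1"] assms(4) by simp
  finally have "real (card \<F>) * (1 - p) ^ (\<theta> + 1)
      \<le> real (card V * ((s + \<theta>) choose (\<theta> + 1))) * (1 - p) ^ (\<theta> + 1)"
    using assms(6) by (intro mult_right_mono) (simp_all only: of_nat_le_iff, simp)
  moreover have "(\<Sum>T\<in>\<F>. (1 - p) ^ card T) = real (card \<F>) * (1 - p) ^ (\<theta> + 1)"
    by (simp add: \<F>_def)
  ultimately have small: "real (card A) \<le> p * real (card U) +
      real (card V) * (real ((s + \<theta>) choose (\<theta> + 1)) * (1 - p) ^ (\<theta> + 1))"
    using A(3) by (simp add: mult.assoc)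
  have "s \<le> card (C v \<inter> A)" if v: "v \<in> V" for v
  proof (rule ccontr)
    assume "\<not> ?thesis"
    moreover have "card (C v) = card (C v \<inter> A) + card (C v - A)"
      using finC[OF v] by (metis card_Int_Diff)
    ultimately have "\<theta> + 1 \<le> card (C v - A)"
      using assms(4)[OF v] by linarith
    then obtain T where "T \<subseteq> C v - A" "card T = \<theta> + 1"
      by (meson obtain_subset_with_card_n)
    then show False
      using A(2) v by (auto simp: \<F>_def)
  qed
  then show ?thesis
    using A(1) small by blast
qed

lemma card_eq_sum_card_fibres:
  fixes r :: nat
  assumes "finite D" "A \<subseteq> D \<times> {..<r}"
  shows "card A = (\<Sum>v\<in>D. card {i \<in> {..<r}. (v, i) \<in> A})"
proof -
  have "A = Sigma D (\<lambda>v. {i \<in> {..<r}. (v, i) \<in> A})"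
    using assms(2) by auto
  then have "card A = card (Sigma D (\<lambda>v. {i \<in> {..<r}. (v, i) \<in> A}))"
    by (rule arg_cong)
  also have "\<dots> = (\<Sum>v\<in>D. card {i \<in> {..<r}. (v, i) \<in> A})"
    using assms(1) by (intro card_SigmaI) auto
  finally show ?thesis .
qed

text \<open>A set of copies of vertices is turned into a function by counting the copies.\<close>

lemma domination_number_le_card:
  fixes r :: nat
  assumes "finite (pverts G)" "\<And>v. v \<in> pverts G \<Longrightarrow> finite (closed_neighbourhood G v)"
    and "\<And>v. v \<in> pverts G \<Longrightarrow> r \<le> rs v"
    and "\<And>v. v \<in> pverts G \<Longrightarrow> D v \<subseteq> closed_neighbourhood G v"
    and "A \<subseteq> pverts G \<times> {..<r}"
    and "\<And>v. v \<in> pverts G \<Longrightarrow> ss v \<le> card ((D v \<times> {..<r}) \<inter> A)"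
  shows "domination_number G rs ss \<le> card A"
proof -
  define f where "f v = card {i \<in> {..<r}. (v, i) \<in> A}" for v
  have "f v \<le> r" for v
    unfolding f_def using card_mono[of "{..<r}" "{i \<in> {..<r}. (v, i) \<in> A}"] by auto
  then have bounded: "bounded_function G rs f"
    using assms(3) le_trans unfolding bounded_function_def by blast
  have "ss v \<le> (\<Sum>u\<in>closed_neighbourhood G v. f u)" if v: "v \<in> pverts G" for v
  proof -
    have "card ((D v \<times> {..<r}) \<inter> A) = (\<Sum>u\<in>D v. card {i \<in> {..<r}. (u, i) \<in> (D v \<times> {..<r}) \<inter> A})"
      using finite_subset[OF assms(4,2)] v by (intro card_eq_sum_card_fibres) auto
    also have "\<dots> = (\<Sum>u\<in>D v. f u)"
      unfolding f_def by (intro sum.cong arg_cong[where f = card]) auto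
    also have "\<dots> \<le> (\<Sum>u\<in>closed_neighbourhood G v. f u)"
      using assms(2,4) v by (intro sum_mono2) auto
    finally show ?thesis
      using assms(6)[OF v] by linarith
  qed
  then have "dominating G ss f"
    by (simp add: dominating_def)
  moreover have "weight G f = card A"
    unfolding weight_def f_def using card_eq_sum_card_fibres[OF assms(1,5)] by simp
  ultimately show ?thesis
    unfolding domination_number_def using bounded by (intro Least_le) blast
qed

lemma card_closed_neighbourhood:
  assumes "pair_graph G" "v \<in> pverts G"
  shows "finite (closed_neighbourhood G v)"
    and "closed_neighbourhood G v \<subseteq> pverts G"
    and "card (closed_neighbourhood G v) = out_degree (with_proj G) v + 1"
proof -
  interpret pair_graph G by fact
  have arcs: "out_arcs (with_proj G) v = Pair v ` {u. (v, u) \<in> parcs G}"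
    by (auto simp: out_arcs_def)
  have sub: "{u. (v, u) \<in> parcs G} \<subseteq> pverts G"
    using in_arcsD2 by auto
  then have fin: "finite {u. (v, u) \<in> parcs G}"
    using pair_finite_verts finite_subset by blast
  then show "finite (closed_neighbourhood G v)"
    by (simp add: closed_neighbourhood_def)
  show "closed_neighbourhood G v \<subseteq> pverts G"
    using sub assms(2) by (auto simp: closed_neighbourhood_def)
  have "(v, v) \<notin> parcs G"
    using pair_no_loops by fastforce
  then show "card (closed_neighbourhood G v) = out_degree (with_proj G) v + 1"
    using fin by (simp add: closed_neighbourhood_def out_degree_def arcs card_image inj_on_def)
qed

text \<open>The choice of \<open>p\<close> balances the two terms of the expected size.\<close>

lemma optimised_expectation_le:
  fixes b r t :: real
  assumes "0 < b" "0 < r" "0 < m" and p: "p = (ln (real m) + ln b - ln r) / real m" and "p \<le> 1"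
  shows "p * r + b * (1 - p) ^ m \<le> (ln (real m) + ln b - ln r + 1) / real m * r"
proof -
  have "(1 - p) ^ m \<le> exp (- p) ^ m"
    using assms(5) exp_ge_add_one_self[of "- p"] by (intro power_mono) auto
  also have "\<dots> = exp (ln (r / (real m * b)))"
    using assms by (simp add: ln_div ln_mult flip: exp_of_nat_mult)
  also have "\<dots> = r / (real m * b)"
    using assms by simp
  finally have "b * (1 - p) ^ m \<le> b * (r / (real m * b))"
    using assms(1) by (intro mult_left_mono) auto
  also have "\<dots> = r / real m"
    using assms(1) by simp
  finally have "p * r + b * (1 - p) ^ m \<le> (p + 1 / real m) * r"
    by (simp add: algebra_simps)
  then show ?thesis
    unfolding p by (simp add: add_divide_distrib)
qed

theorem corollary1:
  fixes G :: "'a pair_pre_digraph"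
    and rs ss :: "'a \<Rightarrow> nat"
    and n \<delta> \<tau> s r \<theta> B :: nat
  assumes "pair_graph G" and "pverts G \<noteq> {}"
    and "n = card (pverts G)"
    and "\<delta> = min_degree G"
    and "\<tau> = Min (rs ` pverts G)"
    and "s = Max (ss ` pverts G)"
    and "r = s div (\<delta> + 1) + 1"
    and "\<theta> = (\<delta> + 1) * r - s"
    and "B = ((\<delta> + 1) * r) choose (s - 1)"
    and "r \<le> \<tau>"
  shows "real (domination_number G rs ss) \<le>
    (ln (real \<theta> + 1) + ln (real B) - ln (real r) + 1) / (real \<theta> + 1) * real r * real n"
proof -
  define V where "V = pverts G"
  define U where "U = V \<times> {..<r}"
  interpret pair_graph G by fact
  have finV: "finite V"
    using pair_finite_verts by (simp add: V_def)
  have r_le: "r \<le> rs v" and ss_le: "ss v \<le> s" if "v \<in> V" for v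
    using that finV order_trans[OF assms(10), of "rs v"] by (auto simp: assms(5,6) V_def)
  have "s < (\<delta> + 1) * r"
    unfolding assms(7) using dividend_less_times_div[of "\<delta> + 1" s] by (simp add: algebra_simps)
  then have N: "(\<delta> + 1) * r = s + \<theta>"
    using assms(8) by simp
  have "\<exists>D. D \<subseteq> closed_neighbourhood G v \<and> card D = \<delta> + 1" if "v \<in> V" for v
  proof -
    have "\<delta> \<le> out_degree (with_proj G) v"
      using that finV by (simp add: assms(4) min_degree_def V_def)
    then have "\<delta> + 1 \<le> card (closed_neighbourhood G v)"
      using card_closed_neighbourhood(3)[OF assms(1)] that by (simp add: V_def)
    then show ?thesis
      by (meson obtain_subset_with_card_n)
  qed
  then obtain D where D: "\<And>v. v \<in> V \<Longrightarrow> D v \<subseteq> closed_neighbourhood G v"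
    "\<And>v. v \<in> V \<Longrightarrow> card (D v) = \<delta> + 1"
    by metis
  define C where "C v = D v \<times> {..<r}" for v
  have C_sub: "C v \<subseteq> U" and C_card: "card (C v) = s + \<theta>" if "v \<in> V" for v
    using D[OF that] card_closed_neighbourhood(2)[OF assms(1), of v] that N
    by (auto simp: C_def U_def V_def card_cartesian_product)
  have card_U: "card U = n * r"
    by (simp add: U_def V_def assms(3) card_cartesian_product)
  have finU: "finite U"
    using finV by (simp add: U_def)
  have dominated: "domination_number G rs ss \<le> card A"
    if "A \<subseteq> U" "\<forall>v\<in>V. s \<le> card (C v \<inter> A)" for A
  proof (rule domination_number_le_card[where D = D and r = r])
    show "ss v \<le> card (D v \<times> {..<r} \<inter> A)" if "v \<in> pverts G" for v
      using ss_le[of v] \<open>\<forall>v\<in>V. _ v\<close> that by (force simp: C_def V_def)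
  qed (use that D r_le finV card_closed_neighbourhood(1)[OF assms(1)] in \<open>auto simp: U_def V_def\<close>)

  have choose_le_B: "((s + \<theta>) choose (\<theta> + 1)) \<le> B"
  proof (cases "s = 0")
    case False
    then have "s + \<theta> - (s - 1) = \<theta> + 1"
      by simp
    then show ?thesis
      unfolding assms(9) N using binomial_symmetric[of "s - 1" "s + \<theta>"] by simp
  qed (simp add: binomial_eq_0)
  have "r > 0"
    by (simp add: assms(7))
  \<comment> \<open>This makes \<open>p\<close> nonnegative. For \<open>s = 0\<close> the truncated \<open>s - 1\<close> gives \<open>B = 1\<close>, whereas
      \<open>(s + \<theta>) choose (\<theta> + 1)\<close> is 0.\<close>
  have r_le_B: "r \<le> (\<theta> + 1) * B"
  proof (cases "s = 0")
    case True
    then show ?thesis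
      by (simp add: assms(7,9))
  next
    case False
    have "r \<le> s + \<theta>"
      unfolding N[symmetric] by simp
    also have "\<dots> \<le> (s + \<theta>) * ((s + \<theta> - 1) choose \<theta>)"
      using False by (simp add: Suc_le_eq zero_less_binomial_iff)
    also have "\<dots> = (\<theta> + 1) * ((s + \<theta>) choose (\<theta> + 1))"
      using times_binomial_minus1_eq[of "\<theta> + 1" "s + \<theta>"] by simp
    also have "\<dots> \<le> (\<theta> + 1) * B"
      using choose_le_B by (rule mult_le_mono2)
    finally show ?thesis .
  qed
  then have "B > 0"
    using \<open>r > 0\<close> by (cases B) auto
  define m where "m = \<theta> + 1"
  define p where "p = (ln (real m) + ln (real B) - ln (real r)) / real m"
  have "ln (real r) \<le> ln (real m * real B)"
    using r_le_B \<open>r > 0\<close> unfolding m_def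
    by (metis ln_mono of_nat_0_less_iff of_nat_le_iff of_nat_mult)
  then have "p \<ge> 0"
    using \<open>B > 0\<close> by (simp add: p_def m_def ln_mult)
  define bound where "bound = (ln (real m) + ln (real B) - ln (real r) + 1) / real m * real r"
  have "real (domination_number G rs ss) \<le> bound * real n"
  proof (cases "p \<le> 1")
    case True
    have "\<exists>A\<subseteq>U. (\<forall>v\<in>V. s \<le> card (C v \<inter> A)) \<and>
        real (card A) \<le> p * real (card U) +
          real (card V) * (real ((s + \<theta>) choose (\<theta> + 1)) * (1 - p) ^ (\<theta> + 1))"
      using finU finV \<open>p \<ge> 0\<close> True
      by (intro exists_small_multiple_hitting_set C_sub C_card)
    then obtain A where A: "A \<subseteq> U" "\<forall>v\<in>V. s \<le> card (C v \<inter> A)"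
      "real (card A) \<le> p * real (card U) +
         real (card V) * (real ((s + \<theta>) choose (\<theta> + 1)) * (1 - p) ^ (\<theta> + 1))"
      by blast
    have "real ((s + \<theta>) choose (\<theta> + 1)) * (1 - p) ^ m \<le> real B * (1 - p) ^ m"
      using choose_le_B True by (intro mult_right_mono) auto
    then have "p * real r + real ((s + \<theta>) choose (\<theta> + 1)) * (1 - p) ^ m \<le> bound"
      using optimised_expectation_le[of "real B" "real r" m p] \<open>B > 0\<close> \<open>r > 0\<close> True
      by (simp add: p_def bound_def m_def)
    then have "(p * real r + real ((s + \<theta>) choose (\<theta> + 1)) * (1 - p) ^ m) * real n \<le> bound * real n"
      by (rule mult_right_mono) simp
    moreover have "real (domination_number G rs ss) \<le> real (card A)"
      using dominated[OF A(1,2)] by simp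
    ultimately show ?thesis
      using A(3) by (simp add: card_U m_def V_def assms(3) algebra_simps)
  next
    case False
    have "bound = (p + 1 / real m) * real r"
      by (simp add: bound_def p_def add_divide_distrib)
    moreover have "1 * real r \<le> (p + 1 / real m) * real r"
      using False by (intro mult_right_mono) (auto intro: add_increasing2)
    ultimately have "real r * real n \<le> bound * real n"
      by (intro mult_right_mono) auto
    moreover have "C v \<inter> U = C v" if "v \<in> V" for v
      using C_sub[OF that] by blast
    then have "domination_number G rs ss \<le> card U"
      using C_card by (intro dominated) auto
    then have "real (domination_number G rs ss) \<le> real n * real r"
      unfolding card_U by (metis of_nat_le_iff of_nat_mult)
    ultimately show ?thesis
      by (simp add: mult.commute)
  qed
  then show ?thesis
    by (simp add: bound_def m_def add.commute)
qed

end
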